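(* Let $\mathcal X$ and $\mathcal Y$ be nonzero Hilbert spaces over $\mathbb F$, let $\mathcal M\subseteq\mathcal X$ and $\mathcal N\subseteq\mathcal Y$ be arbitrary nonzero linear manifolds, and let $\mathcal Z$ be an arbitrary Banach space over $\mathbb F$. Then every bounded bilinear map $\phi:\mathcal M\times\mathcal N\to\mathcal Z$ has a bounded bilinear extension $\widehat\phi:\mathcal X\times\mathcal Y\to\mathcal Z$ (that is, $\widehat\phi|_{\mathcal M\times\mathcal N}=\phi$) such that $\|\widehat\phi\|=\|\phi\|$.
   Context: $\mathbb F$ is either the real or the complex field; all linear spaces are over the same $\mathbb F$. A linear manifold of a normed space is a (not necessarily closed) linear subspace, equipped with the inherited norm. A bilinear map $\phi:\mathcal X\times\mathcal Y\to\mathcal Z$ between normed spaces is bounded if $\|\phi\|=\sup_{0\ne x\in\mathcal X,\,0\ne y\in\mathcal Y}\frac{\|\phi(x,y)\|}{\|x\|\,\|y\|}$ is finite. *)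

theory Defs
  imports "HOL-Analysis.Analysis"
begin

text \<open>
  The scalar fields \<open>\<real>\<close> and \<open>\<complex>\<close>, treated uniformly: up to isometric isomorphism they are the only
  members of this class. The first disjunct says that the field is \<open>\<real>\<close>, the second that it is
  \<open>\<real>(i)\<close> with \<open>i\<^sup>2 = -1\<close>; the last axiom says that the norm is the usual absolute value.
\<close>

class real_or_complex = real_normed_field +
  fixes conj_scalar :: "'a \<Rightarrow> 'a"
  assumes real_or_complex:
    "(\<forall>z. conj_scalar z = z \<and> (\<exists>a. z = a *\<^sub>R 1)) \<or>
     (\<exists>i. i * i = - 1 \<and>
        (\<forall>z. \<exists>a b. z = a *\<^sub>R 1 + b *\<^sub>R i) \<and>
        (\<forall>a b. conj_scalar (a *\<^sub>R 1 + b *\<^sub>R i) = a *\<^sub>R 1 - b *\<^sub>R i))"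
    and mult_conj_scalar: "z * conj_scalar z = ((norm z)\<^sup>2) *\<^sub>R 1"

instantiation real :: real_or_complex
begin
definition conj_scalar_real :: "real \<Rightarrow> real" where "conj_scalar_real x = x"
instance
  by standard (simp_all add: conj_scalar_real_def power2_eq_square)
end

instantiation complex :: real_or_complex
begin
definition conj_scalar_complex :: "complex \<Rightarrow> complex" where "conj_scalar_complex = cnj"
instance
proof
  have "\<exists>a b. z = a *\<^sub>R 1 + b *\<^sub>R \<i>" for z :: complex
    by (rule exI[of _ "Re z"], rule exI[of _ "Im z"]) (simp add: complex_eq_iff)
  moreover have "cnj (a *\<^sub>R 1 + b *\<^sub>R \<i>) = a *\<^sub>R 1 - b *\<^sub>R \<i>" for a b
    by (simp add: complex_eq_iff)
  ultimately show "(\<forall>z::complex. conj_scalar z = z \<and> (\<exists>a. z = a *\<^sub>R 1)) \<or>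
     (\<exists>i::complex. i * i = - 1 \<and>
        (\<forall>z. \<exists>a b. z = a *\<^sub>R 1 + b *\<^sub>R i) \<and>
        (\<forall>a b. conj_scalar (a *\<^sub>R 1 + b *\<^sub>R i) = a *\<^sub>R 1 - b *\<^sub>R i))"
    unfolding conj_scalar_complex_def by (intro disjI2 exI[of _ \<i>]) auto
  show "z * conj_scalar z = ((norm z)\<^sup>2) *\<^sub>R 1" for z :: complex
    using complex_norm_square[of z] by (simp add: conj_scalar_complex_def scaleR_conv_of_real)
qed
end

text \<open>
  The type supplies addition, norm and (for \<^class>\<open>banach\<close> types) completeness; the scalar
  multiplication over the field is explicit and extends the real one of the type.
\<close>

locale normed_space_over = vector_space scale
  for scale :: "'f::real_or_complex \<Rightarrow> 'x::real_normed_vector \<Rightarrow> 'x" +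
  assumes scale_of_real: "scale (of_real r) x = r *\<^sub>R x"
    and norm_scale: "norm (scale c x) = norm c * norm x"

text \<open>Positive definiteness of the inner product follows from \<open>ip_self\<close>.\<close>

locale hilbert_space_over = normed_space_over scale
  for scale :: "'f::real_or_complex \<Rightarrow> 'x::banach \<Rightarrow> 'x" +
  fixes ip :: "'x \<Rightarrow> 'x \<Rightarrow> 'f"
  assumes ip_add_left: "ip (x + y) z = ip x z + ip y z"
    and ip_scale_left: "ip (scale c x) z = c * ip x z"
    and ip_conj: "ip y x = conj_scalar (ip x y)"
    and ip_self: "ip x x = of_real ((norm x)\<^sup>2)"

lemma hilbert_space_over_real_inner:
  "hilbert_space_over scaleR (inner :: 'x::{real_inner, banach} \<Rightarrow> 'x \<Rightarrow> real)"
  by unfold_locales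
    (simp_all add: algebra_simps conj_scalar_real_def inner_commute power2_norm_eq_inner)

lemma hilbert_space_over_complex: "hilbert_space_over (*) (\<lambda>z w :: complex. z * cnj w)"
  by unfold_locales
    (simp_all add: algebra_simps conj_scalar_complex_def norm_mult scaleR_conv_of_real
      complex_norm_square [symmetric] del: of_real_power)

text \<open>
  A map on \<open>M \<times> N\<close> is represented by a total curried function whose values outside \<open>M \<times> N\<close> are
  irrelevant.
\<close>

definition bilinear_on ::
  "('f \<Rightarrow> 'x \<Rightarrow> 'x) \<Rightarrow> ('f \<Rightarrow> 'y \<Rightarrow> 'y) \<Rightarrow> ('f \<Rightarrow> 'z \<Rightarrow> 'z) \<Rightarrow>
    'x::ab_group_add set \<Rightarrow> 'y::ab_group_add set \<Rightarrow> ('x \<Rightarrow> 'y \<Rightarrow> 'z::ab_group_add) \<Rightarrow> bool"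
  where "bilinear_on sX sY sZ M N \<phi> \<longleftrightarrow>
    (\<forall>x\<in>M. \<forall>x'\<in>M. \<forall>y\<in>N. \<phi> (x + x') y = \<phi> x y + \<phi> x' y) \<and>
    (\<forall>c. \<forall>x\<in>M. \<forall>y\<in>N. \<phi> (sX c x) y = sZ c (\<phi> x y)) \<and>
    (\<forall>x\<in>M. \<forall>y\<in>N. \<forall>y'\<in>N. \<phi> x (y + y') = \<phi> x y + \<phi> x y') \<and>
    (\<forall>c. \<forall>x\<in>M. \<forall>y\<in>N. \<phi> x (sY c y) = sZ c (\<phi> x y))"

definition bilinear_ratios ::
  "'x::real_normed_vector set \<Rightarrow> 'y::real_normed_vector set \<Rightarrow>
    ('x \<Rightarrow> 'y \<Rightarrow> 'z::real_normed_vector) \<Rightarrow> real set"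
  where "bilinear_ratios M N \<phi> =
    {norm (\<phi> x y) / (norm x * norm y) | x y. x \<in> M \<and> x \<noteq> 0 \<and> y \<in> N \<and> y \<noteq> 0}"

definition bounded_bilinear_on ::
  "('f \<Rightarrow> 'x \<Rightarrow> 'x) \<Rightarrow> ('f \<Rightarrow> 'y \<Rightarrow> 'y) \<Rightarrow> ('f \<Rightarrow> 'z \<Rightarrow> 'z) \<Rightarrow>
    'x::real_normed_vector set \<Rightarrow> 'y::real_normed_vector set \<Rightarrow>
    ('x \<Rightarrow> 'y \<Rightarrow> 'z::real_normed_vector) \<Rightarrow> bool"
  where "bounded_bilinear_on sX sY sZ M N \<phi> \<longleftrightarrow>
    bilinear_on sX sY sZ M N \<phi> \<and> bdd_above (bilinear_ratios M N \<phi>)"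

text \<open>The real \<^const>\<open>Sup\<close> is meaningful only for bounded \<open>\<phi>\<close> and nonzero \<open>M\<close>, \<open>N\<close>.\<close>

definition bilinear_norm_on ::
  "'x::real_normed_vector set \<Rightarrow> 'y::real_normed_vector set \<Rightarrow>
    ('x \<Rightarrow> 'y \<Rightarrow> 'z::real_normed_vector) \<Rightarrow> real"
  where "bilinear_norm_on M N \<phi> = Sup (bilinear_ratios M N \<phi>)"

end

theory Submission imports Defs begin

text \<open>
  The extension is \<open>(x, y) \<mapsto> \<phi>' (P x) (Q y)\<close>, where \<open>P\<close> and \<open>Q\<close> are the orthogonal projections onto
  the closures of \<open>M\<close> and \<open>N\<close> and \<open>\<phi>'\<close> is the continuous extension of \<open>\<phi>\<close> to the closures. Projections
  fix the points of the manifolds and do not increase norms, so neither does the extension; it cannot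
  decrease the norm because it agrees with \<open>\<phi>\<close> on \<open>M \<times> N\<close>.

  It suffices to extend in one variable (\<open>extend_first_variable\<close>), leaving the other one in an arbitrary
  manifold of a normed space, and to apply this twice, exchanging the variables in between.

  The projection and the continuous extension are handled together: a sequence in \<open>M\<close> is said
  to approximate \<open>x\<close> if it converges to a point \<open>p\<close> with \<open>x - p\<close> orthogonal to \<open>M\<close>, that is, to \<open>P x\<close>.
  The value of the extension at \<open>x\<close> is the limit of \<open>\<phi>\<close> along any approximating sequence. Such sequences
  exist because minimizing sequences for the distance from \<open>x\<close> to \<open>M\<close> are Cauchy by the parallelogram law,
  and they can be added and scaled, which makes the extension linear.
\<close>

section \<open>Real or complex scalars and inner products\<close>

lemma conj_scalar_of_real: "conj_scalar (of_real r :: 'f::real_or_complex) = of_real r"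
  using real_or_complex[where 'a='f]
proof
  assume "\<exists>i::'f. i * i = - 1 \<and> (\<forall>z. \<exists>a b. z = a *\<^sub>R 1 + b *\<^sub>R i) \<and>
        (\<forall>a b. conj_scalar (a *\<^sub>R 1 + b *\<^sub>R i) = a *\<^sub>R 1 - b *\<^sub>R i)"
  then obtain i :: 'f where "\<And>a b. conj_scalar (a *\<^sub>R 1 + b *\<^sub>R i) = a *\<^sub>R 1 - b *\<^sub>R i"
    by blast
  from this[of r 0] show ?thesis by (simp add: of_real_def)
qed simp

lemma conj_scalar_add: "conj_scalar (z + w :: 'f::real_or_complex) = conj_scalar z + conj_scalar w"
  using real_or_complex[where 'a='f]
proof
  assume "\<exists>i::'f. i * i = - 1 \<and> (\<forall>z. \<exists>a b. z = a *\<^sub>R 1 + b *\<^sub>R i) \<and>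
        (\<forall>a b. conj_scalar (a *\<^sub>R 1 + b *\<^sub>R i) = a *\<^sub>R 1 - b *\<^sub>R i)"
  then obtain i :: 'f where gen: "\<And>z. \<exists>a b. z = a *\<^sub>R 1 + b *\<^sub>R i"
    and conj: "\<And>a b. conj_scalar (a *\<^sub>R 1 + b *\<^sub>R i) = a *\<^sub>R 1 - b *\<^sub>R i"
    by blast
  obtain a b where z: "z = a *\<^sub>R 1 + b *\<^sub>R i" using gen by blast
  obtain a' b' where w: "w = a' *\<^sub>R 1 + b' *\<^sub>R i" using gen by blast
  have "z + w = (a + a') *\<^sub>R 1 + (b + b') *\<^sub>R i" by (simp add: z w algebra_simps)
  then have "conj_scalar (z + w) = (a + a') *\<^sub>R 1 - (b + b') *\<^sub>R i" by (simp only: conj)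
  then show ?thesis by (simp add: z w conj algebra_simps)
qed simp

lemma conj_scalar_zero: "conj_scalar (0 :: 'f::real_or_complex) = 0"
  using conj_scalar_of_real[of 0] by simp

lemma conj_scalar_minus: "conj_scalar (- z :: 'f::real_or_complex) = - conj_scalar z"
  using conj_scalar_add[of z "- z"] by (simp add: conj_scalar_zero eq_neg_iff_add_eq_0 add.commute)

lemma (in normed_space_over) bounded_linear_scale: "bounded_linear (scale c)"
proof (rule bounded_linear_intro)
  fix r x
  show "scale c (r *\<^sub>R x) = r *\<^sub>R scale c x"
    by (simp flip: scale_of_real add: mult.commute)
  show "norm (scale c x) \<le> norm x * norm c" by (simp add: norm_scale)
qed (rule scale_right_distrib)

context hilbert_space_over
begin

lemma ip_add_right: "ip x (y + z) = ip x y + ip x z"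
  by (metis ip_conj ip_add_left conj_scalar_add)

lemma ip_minus_left: "ip (- x) y = - ip x y"
  using ip_scale_left[of "- 1" x y] by simp

lemma ip_minus_right: "ip x (- y) = - ip x y"
  by (metis ip_conj ip_minus_left conj_scalar_minus)

lemma ip_diff_left: "ip (x - y) z = ip x z - ip y z"
  using ip_add_left[of x "- y" z] by (simp add: ip_minus_left)

lemma ip_diff_right: "ip x (y - z) = ip x y - ip x z"
  using ip_add_right[of x y "- z"] by (simp add: ip_minus_right)

lemma parallelogram:
  fixes x y :: 'x
  shows "(norm (x + y))\<^sup>2 + (norm (x - y))\<^sup>2 = 2 * (norm x)\<^sup>2 + 2 * (norm y)\<^sup>2"
proof -
  have "of_real ((norm (x + y))\<^sup>2 + (norm (x - y))\<^sup>2)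
      = (of_real (2 * (norm x)\<^sup>2 + 2 * (norm y)\<^sup>2) :: 'f)"
    unfolding of_real_add of_real_mult of_real_numeral ip_self[symmetric]
    unfolding ip_add_left ip_add_right ip_diff_left ip_diff_right by algebra
  then show ?thesis by (simp only: of_real_eq_iff)
qed

lemma pythagoras:
  assumes "ip x y = 0"
  shows "(norm (x + y))\<^sup>2 = (norm x)\<^sup>2 + (norm y)\<^sup>2"
proof -
  have "ip y x = 0" using assms ip_conj[of y x] by (simp add: conj_scalar_zero)
  with assms have "of_real ((norm (x + y))\<^sup>2) = (of_real ((norm x)\<^sup>2 + (norm y)\<^sup>2) :: 'f)"
    unfolding of_real_add ip_self[symmetric] by (simp add: ip_add_left ip_add_right)
  then show ?thesis by (simp only: of_real_eq_iff)
qed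

text \<open>
  The coefficient \<open>s * ip q m\<close> points in the direction of steepest descent, so that both cross terms
  of the expanded square are real.
\<close>

lemma norm_diff_along:
  "(norm (q - scale (of_real s * ip q m) m))\<^sup>2
    = (norm q)\<^sup>2 - 2 * s * (norm (ip q m))\<^sup>2 + s\<^sup>2 * (norm (ip q m))\<^sup>2 * (norm m)\<^sup>2"
proof -
  let ?c = "ip q m" and ?d = "of_real s * ip q m"
  have "ip m q = conj_scalar ?c" by (rule ip_conj)
  then have 1: "ip (scale ?d m) q = of_real (s * (norm ?c)\<^sup>2)"
    using mult_conj_scalar[of ?c] by (simp add: ip_scale_left mult.assoc of_real_def)
  then have 2: "ip q (scale ?d m) = of_real (s * (norm ?c)\<^sup>2)"
    using ip_conj[of q "scale ?d m"] by (simp only: conj_scalar_of_real)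
  have 3: "ip (scale ?d m) (scale ?d m) = of_real (s\<^sup>2 * (norm ?c)\<^sup>2 * (norm m)\<^sup>2)"
    unfolding ip_self norm_scale norm_mult by (simp add: power_mult_distrib)
  have "of_real ((norm (q - scale ?d m))\<^sup>2) = ip (q - scale ?d m) (q - scale ?d m)"
    by (rule ip_self[symmetric])
  also have "\<dots> = ip q q - ip (scale ?d m) q - (ip q (scale ?d m) - ip (scale ?d m) (scale ?d m))"
    by (simp only: ip_diff_left ip_diff_right)
  also have "\<dots> = (of_real ((norm q)\<^sup>2 - 2 * s * (norm ?c)\<^sup>2 + s\<^sup>2 * (norm ?c)\<^sup>2 * (norm m)\<^sup>2) :: 'f)"
    unfolding 1 2 3 ip_self[of q] of_real_diff of_real_add of_real_mult by (simp add: algebra_simps)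
  finally show ?thesis by (simp only: of_real_eq_iff)
qed

section \<open>Sequences that approximate the orthogonal projection\<close>

definition projection_seq :: "'x set \<Rightarrow> 'x \<Rightarrow> (nat \<Rightarrow> 'x) \<Rightarrow> bool" where
  "projection_seq M x u \<longleftrightarrow>
    (\<forall>n. u n \<in> M) \<and> (\<exists>p. u \<longlonglongrightarrow> p \<and> (\<forall>m\<in>M. ip (x - p) m = 0))"

lemma projection_seq_const: "x \<in> M \<Longrightarrow> projection_seq M x (\<lambda>_. x)"
  unfolding projection_seq_def using ip_minus_left[of 0] ip_diff_left[of x x] by auto

lemma projection_seq_add:
  assumes "subspace M" "projection_seq M x u" "projection_seq M y v"
  shows "projection_seq M (x + y) (\<lambda>n. u n + v n)"
proof -
  obtain p q where p: "u \<longlonglongrightarrow> p" "\<forall>m\<in>M. ip (x - p) m = 0"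
    and q: "v \<longlonglongrightarrow> q" "\<forall>m\<in>M. ip (y - q) m = 0"
    using assms unfolding projection_seq_def by blast
  have "(\<lambda>n. u n + v n) \<longlonglongrightarrow> p + q" using p q by (intro tendsto_add)
  moreover have "ip (x + y - (p + q)) m = 0" if "m \<in> M" for m
    using p q that by (metis add_diff_add ip_add_left add_0)
  ultimately show ?thesis
    using assms subspace_add unfolding projection_seq_def by blast
qed

lemma projection_seq_scale:
  assumes "subspace M" "projection_seq M x u"
  shows "projection_seq M (scale c x) (\<lambda>n. scale c (u n))"
proof -
  obtain p where p: "u \<longlonglongrightarrow> p" "\<forall>m\<in>M. ip (x - p) m = 0"
    using assms unfolding projection_seq_def by blast
  have "(\<lambda>n. scale c (u n)) \<longlonglongrightarrow> scale c p"
    using p by (intro bounded_linear.tendsto[OF bounded_linear_scale])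
  moreover have "ip (scale c x - scale c p) m = 0" if "m \<in> M" for m
    using p that by (simp flip: scale_right_diff_distrib add: ip_scale_left)
  ultimately show ?thesis
    using assms subspace_scale unfolding projection_seq_def by blast
qed

text \<open>
  Projecting does not increase the norm: by Pythagoras, \<open>norm m \<le> norm (x - p + m)\<close> for every \<open>m\<close> in the
  manifold, and the right-hand side tends to \<open>norm x\<close> when \<open>m\<close> tends to \<open>p\<close>.
\<close>

lemma projection_seq_limit:
  assumes "projection_seq M x u"
  obtains p where "u \<longlonglongrightarrow> p" "norm p \<le> norm x"
proof -
  obtain p where p: "u \<longlonglongrightarrow> p" "\<forall>m\<in>M. ip (x - p) m = 0" and u: "\<And>n. u n \<in> M"
    using assms unfolding projection_seq_def by blast
  have "norm (u n) \<le> norm (x - p + u n)" for n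
  proof (rule power2_le_imp_le)
    show "(norm (u n))\<^sup>2 \<le> (norm (x - p + u n))\<^sup>2"
      using pythagoras[of "x - p" "u n"] p u by simp
  qed simp
  moreover have "(\<lambda>n. norm (u n)) \<longlonglongrightarrow> norm p" "(\<lambda>n. norm (x - p + u n)) \<longlonglongrightarrow> norm (x - p + p)"
    by (intro tendsto_intros p)+
  ultimately have "norm p \<le> norm (x - p + p)" by (intro LIMSEQ_le) auto
  with p that show ?thesis by simp
qed

text \<open>The projection is unique: the difference of two approximating sequences of \<open>x\<close> approximates \<open>0\<close>.\<close>

lemma projection_seq_diff_tendsto_0:
  assumes "subspace M" "projection_seq M x u" "projection_seq M x v"
  shows "(\<lambda>n. u n - v n) \<longlonglongrightarrow> 0"
proof -
  have "projection_seq M 0 (\<lambda>n. u n - v n)"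
    using projection_seq_add[OF assms(1,2) projection_seq_scale[OF assms(1,3), of "- 1"]] by simp
  then obtain p where "(\<lambda>n. u n - v n) \<longlonglongrightarrow> p" "norm p \<le> norm (0 :: 'x)"
    by (rule projection_seq_limit)
  then show ?thesis by simp
qed

text \<open>
  A sequence in \<open>M\<close> whose squared distances to \<open>x\<close> tend to their infimum \<open>D\<close> is Cauchy, since the midpoint
  of two of its points is in \<open>M\<close> and hence also has squared distance at least \<open>D\<close>. Its limit \<open>p\<close> is a
  nearest point, and then \<open>x - p\<close> is orthogonal to \<open>M\<close>, for otherwise a small step along an element of \<open>M\<close>
  would come nearer.
\<close>

lemma projection_seq_exists:
  assumes M: "subspace M"
  shows "\<exists>u. projection_seq M x u"
proof -
  define S where "S = (\<lambda>m. (norm (x - m))\<^sup>2) ` M"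
  define D where "D = Inf S"
  have ne: "S \<noteq> {}" using subspace_0[OF M] by (auto simp: S_def)
  have bdd: "bdd_below S" by (rule bdd_belowI[of _ 0]) (auto simp: S_def)
  have D_le: "D \<le> (norm (x - m))\<^sup>2" if "m \<in> M" for m
    unfolding D_def by (rule cInf_lower) (use that bdd in \<open>auto simp: S_def\<close>)
  have "\<exists>m\<in>M. (norm (x - m))\<^sup>2 < D + 1 / real (Suc n)" for n
    using cInf_lessD[OF ne, of "D + 1 / real (Suc n)"] by (auto simp: D_def S_def)
  then obtain u where u: "\<And>n. u n \<in> M" "\<And>n. (norm (x - u n))\<^sup>2 < D + 1 / real (Suc n)"
    by metis
  have close: "(norm (u k - u l))\<^sup>2 \<le> 2 / real (Suc k) + 2 / real (Suc l)" for k l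
  proof -
    define h where "h = scale (of_real (1/2)) (u k + u l)"
    have h: "h \<in> M" using u M by (simp add: h_def subspace_add subspace_scale)
    have "h = (1/2) *\<^sub>R (u k + u l)" unfolding h_def by (rule scale_of_real)
    then have "(x - u k) + (x - u l) = 2 *\<^sub>R (x - h)"
      by (simp add: algebra_simps scaleR_2)
    then have "(norm ((x - u k) + (x - u l)))\<^sup>2 = 4 * (norm (x - h))\<^sup>2"
      by (simp add: power_mult_distrib)
    with parallelogram[of "x - u k" "x - u l"] D_le[OF h] u(2)[of k] u(2)[of l]
    show ?thesis by (simp add: norm_minus_commute)
  qed
  have "Cauchy u"
  proof (rule metric_CauchyI)
    fix e :: real assume e: "0 < e"
    obtain K where K: "4 / e\<^sup>2 < real K" using reals_Archimedean2 by blast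
    have *: "2 / real (Suc k) < e\<^sup>2 / 2" if "K \<le> k" for k
    proof -
      have "4 / e\<^sup>2 < real (Suc k)" using K that by linarith
      then show ?thesis using e by (simp add: field_simps)
    qed
    have "dist (u k) (u l) < e" if "K \<le> k" "K \<le> l" for k l
    proof -
      have "(norm (u k - u l))\<^sup>2 < e\<^sup>2" using close[of k l] *[OF that(1)] *[OF that(2)] by linarith
      then show ?thesis using e by (simp add: dist_norm power_less_imp_less_base)
    qed
    then show "\<exists>K. \<forall>k\<ge>K. \<forall>l\<ge>K. dist (u k) (u l) < e" by blast
  qed
  then obtain p where p: "u \<longlonglongrightarrow> p" using Cauchy_convergent convergentD by blast
  have nearest: "(norm (x - p))\<^sup>2 \<le> D"
  proof (rule LIMSEQ_le)
    show "(\<lambda>n. (norm (x - u n))\<^sup>2) \<longlonglongrightarrow> (norm (x - p))\<^sup>2" by (intro tendsto_intros p)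
    have "(\<lambda>n. D + 1 / real (Suc n)) \<longlonglongrightarrow> D + 0"
      using LIMSEQ_inverse_real_of_nat by (intro tendsto_intros) (simp add: inverse_eq_divide)
    then show "(\<lambda>n. D + 1 / real (Suc n)) \<longlonglongrightarrow> D" by simp
  qed (use u(2) less_imp_le in blast)
  have "ip (x - p) m = 0" if m: "m \<in> M" for m
  proof -
    define c where "c = ip (x - p) m"
    define s where "s = 1 / (1 + (norm m)\<^sup>2)"
    have pos: "1 + (norm m)\<^sup>2 > 0" by (smt (verit) zero_le_power2)
    \<comment> \<open>This \<open>s\<close> makes the linear decrease outweigh the quadratic increase of the squared distance.\<close>
    have s: "s > 0" "s * (norm m)\<^sup>2 \<le> 1" using pos by (simp_all add: s_def field_simps)
    have "D \<le> (norm (x - p - scale (of_real s * c) m))\<^sup>2"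
    proof (rule LIMSEQ_le_const)
      show "(\<lambda>n. (norm (x - u n - scale (of_real s * c) m))\<^sup>2)
          \<longlonglongrightarrow> (norm (x - p - scale (of_real s * c) m))\<^sup>2"
        by (intro tendsto_intros p)
      have "D \<le> (norm (x - u n - scale (of_real s * c) m))\<^sup>2" for n
        using D_le[of "u n + scale (of_real s * c) m"] u m M
        by (simp add: subspace_add subspace_scale diff_diff_eq)
      then show "\<exists>K. \<forall>n\<ge>K. D \<le> (norm (x - u n - scale (of_real s * c) m))\<^sup>2" by blast
    qed
    also have "\<dots> = (norm (x - p))\<^sup>2 - 2 * s * (norm c)\<^sup>2 + s\<^sup>2 * (norm c)\<^sup>2 * (norm m)\<^sup>2"
      unfolding c_def by (rule norm_diff_along)
    finally have "2 * s * (norm c)\<^sup>2 \<le> s\<^sup>2 * (norm c)\<^sup>2 * (norm m)\<^sup>2" using nearest by linarith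
    also have "\<dots> = (s * (norm m)\<^sup>2) * (s * (norm c)\<^sup>2)" by (simp add: power2_eq_square)
    also have "\<dots> \<le> 1 * (s * (norm c)\<^sup>2)" using s by (intro mult_right_mono) auto
    finally have "s * (norm c)\<^sup>2 \<le> 0" by linarith
    with s have "(norm c)\<^sup>2 \<le> 0" by (simp add: mult_le_0_iff)
    then show ?thesis by (simp add: c_def)
  qed
  with u p show ?thesis unfolding projection_seq_def by blast
qed

end

section \<open>Extension of a bilinear map in one variable\<close>

text \<open>
  For fixed \<open>y\<close>, the map \<open>\<phi>\<close> is Lipschitz in its first argument, so it sends an approximating sequence of
  \<open>x\<close> to a convergent one. The constant \<open>C\<close> is kept, and \<open>N\<close> stays a mere manifold, so that the lemma
  applies again with the two variables exchanged.
\<close>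

lemma extend_first_variable:
  fixes sX :: "'f::real_or_complex \<Rightarrow> 'x::banach \<Rightarrow> 'x"
    and sY :: "'f \<Rightarrow> 'y::real_normed_vector \<Rightarrow> 'y"
    and sZ :: "'f \<Rightarrow> 'z::banach \<Rightarrow> 'z"
    and \<phi> :: "'x \<Rightarrow> 'y \<Rightarrow> 'z"
  assumes X: "hilbert_space_over sX ipX" and Y: "normed_space_over sY" and Z: "normed_space_over sZ"
    and M: "module.subspace sX M" and N: "module.subspace sY N"
    and \<phi>: "bilinear_on sX sY sZ M N \<phi>"
    and C: "\<And>x y. x \<in> M \<Longrightarrow> y \<in> N \<Longrightarrow> norm (\<phi> x y) \<le> C * norm x * norm y" "0 \<le> C"
  obtains \<psi> where "bilinear_on sX sY sZ UNIV N \<psi>"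
    and "\<And>x y. x \<in> M \<Longrightarrow> y \<in> N \<Longrightarrow> \<psi> x y = \<phi> x y"
    and "\<And>x y. y \<in> N \<Longrightarrow> norm (\<psi> x y) \<le> C * norm x * norm y"
proof -
  interpret X: hilbert_space_over sX ipX by fact
  interpret Y: normed_space_over sY by fact
  interpret Z: normed_space_over sZ by fact
  have add1: "\<phi> (x + x') y = \<phi> x y + \<phi> x' y" if "x \<in> M" "x' \<in> M" "y \<in> N" for x x' y
    using \<phi> that unfolding bilinear_on_def by blast
  have scale1: "\<phi> (sX c x) y = sZ c (\<phi> x y)" if "x \<in> M" "y \<in> N" for c x y
    using \<phi> that unfolding bilinear_on_def by blast
  have add2: "\<phi> x (y + y') = \<phi> x y + \<phi> x y'" if "x \<in> M" "y \<in> N" "y' \<in> N" for x y y'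
    using \<phi> that unfolding bilinear_on_def by blast
  have scale2: "\<phi> x (sY c y) = sZ c (\<phi> x y)" if "x \<in> M" "y \<in> N" for c x y
    using \<phi> that unfolding bilinear_on_def by blast
  have diff1: "\<phi> (x - x') y = \<phi> x y - \<phi> x' y" if "x \<in> M" "x' \<in> M" "y \<in> N" for x x' y
    using add1[of "x - x'" x' y] that M by (simp add: X.subspace_diff)
  have Z_tendsto: "(\<lambda>n. sZ c (f n)) \<longlonglongrightarrow> sZ c l" if "f \<longlonglongrightarrow> l" for c and f :: "nat \<Rightarrow> 'z" and l
    using that by (rule bounded_linear.tendsto[OF Z.bounded_linear_scale])

  obtain U where U: "\<And>x. X.projection_seq M x (U x)"
    using X.projection_seq_exists[OF M] by metis
  define \<psi> where "\<psi> x y = lim (\<lambda>n. \<phi> (U x n) y)" for x y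
  have in_M: "u n \<in> M" if "X.projection_seq M x u" for x u n
    using that unfolding X.projection_seq_def by blast
  have conv: "convergent (\<lambda>n. \<phi> (u n) y)" if u: "X.projection_seq M x u" and y: "y \<in> N" for x u y
  proof -
    have "Cauchy u"
      using u unfolding X.projection_seq_def by (metis LIMSEQ_imp_Cauchy)
    have "Cauchy (\<lambda>n. \<phi> (u n) y)"
    proof (rule metric_CauchyI)
      fix e :: real assume e: "0 < e"
      define K where "K = C * norm y + 1"
      have K: "K > 0" using C(2) by (simp add: K_def add_nonneg_pos)
      obtain L where L: "\<forall>k\<ge>L. \<forall>l\<ge>L. dist (u k) (u l) < e / K"
        using metric_CauchyD[OF \<open>Cauchy u\<close>, of "e / K"] e K by auto
      have "dist (\<phi> (u k) y) (\<phi> (u l) y) < e" if "k \<ge> L" "l \<ge> L" for k l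
      proof -
        have "dist (\<phi> (u k) y) (\<phi> (u l) y) = norm (\<phi> (u k - u l) y)"
          using in_M[OF u] y by (simp add: diff1 dist_norm)
        also have "\<dots> \<le> C * norm (u k - u l) * norm y"
          using in_M[OF u] y M by (intro C) (auto simp: X.subspace_diff)
        also have "\<dots> \<le> K * dist (u k) (u l)" by (simp add: K_def dist_norm algebra_simps)
        also have "\<dots> < e" using L that K by (simp add: field_simps)
        finally show ?thesis .
      qed
      then show "\<exists>L. \<forall>k\<ge>L. \<forall>l\<ge>L. dist (\<phi> (u k) y) (\<phi> (u l) y) < e" by blast
    qed
    then show ?thesis by (rule Cauchy_convergent)
  qed
  \<comment> \<open>The limit does not depend on the approximating sequence; linearity rests on this freedom.\<close>
  have lim: "(\<lambda>n. \<phi> (u n) y) \<longlonglongrightarrow> \<psi> x y" if u: "X.projection_seq M x u" and y: "y \<in> N" for x u y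
  proof -
    have 1: "(\<lambda>n. \<phi> (U x n) y) \<longlonglongrightarrow> \<psi> x y"
      unfolding \<psi>_def by (rule convergent_LIMSEQ_iff[THEN iffD1, OF conv[OF U y]])
    have "(\<lambda>n. u n - U x n) \<longlonglongrightarrow> 0"
      using X.projection_seq_diff_tendsto_0[OF M u U] .
    then have bound: "(\<lambda>n. C * norm (u n - U x n) * norm y) \<longlonglongrightarrow> C * norm (0 :: 'x) * norm y"
      by (intro tendsto_intros)
    have "norm (\<phi> (u n - U x n) y) \<le> C * norm (u n - U x n) * norm y" for n
      using in_M[OF u] in_M[OF U] y M by (intro C X.subspace_diff)
    then have "(\<lambda>n. \<phi> (u n - U x n) y) \<longlonglongrightarrow> 0"
      by (rule Lim_null_comparison[OF always_eventually, OF allI]) (use bound in simp)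
    with 1 have "(\<lambda>n. \<phi> (u n - U x n) y + \<phi> (U x n) y) \<longlonglongrightarrow> 0 + \<psi> x y"
      by (intro tendsto_add)
    then show ?thesis using in_M[OF u] in_M[OF U] y by (simp add: diff1)
  qed

  show thesis
  proof
    show "bilinear_on sX sY sZ UNIV N \<psi>"
      unfolding bilinear_on_def
    proof (intro conjI ballI allI)
      fix x x' y assume y: "y \<in> N"
      have "(\<lambda>n. \<phi> (U x n + U x' n) y) \<longlonglongrightarrow> \<psi> (x + x') y"
        by (rule lim[OF X.projection_seq_add[OF M U U] y])
      moreover have "(\<lambda>n. \<phi> (U x n + U x' n) y) \<longlonglongrightarrow> \<psi> x y + \<psi> x' y"
        using tendsto_add[OF lim[OF U y] lim[OF U y]] in_M[OF U] y by (simp add: add1)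
      ultimately show "\<psi> (x + x') y = \<psi> x y + \<psi> x' y" by (rule LIMSEQ_unique)
    next
      fix c x y assume y: "y \<in> N"
      have "(\<lambda>n. \<phi> (sX c (U x n)) y) \<longlonglongrightarrow> \<psi> (sX c x) y"
        by (rule lim[OF X.projection_seq_scale[OF M U] y])
      moreover have "(\<lambda>n. \<phi> (sX c (U x n)) y) \<longlonglongrightarrow> sZ c (\<psi> x y)"
        using Z_tendsto[OF lim[OF U y]] in_M[OF U] y by (simp add: scale1)
      ultimately show "\<psi> (sX c x) y = sZ c (\<psi> x y)" by (rule LIMSEQ_unique)
    next
      fix x y y' assume y: "y \<in> N" "y' \<in> N"
      have "(\<lambda>n. \<phi> (U x n) (y + y')) \<longlonglongrightarrow> \<psi> x (y + y')"
        using y N by (intro lim[OF U] Y.subspace_add)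
      moreover have "(\<lambda>n. \<phi> (U x n) (y + y')) \<longlonglongrightarrow> \<psi> x y + \<psi> x y'"
        using tendsto_add[OF lim[OF U y(1)] lim[OF U y(2)]] in_M[OF U] y by (simp add: add2)
      ultimately show "\<psi> x (y + y') = \<psi> x y + \<psi> x y'" by (rule LIMSEQ_unique)
    next
      fix c x y assume y: "y \<in> N"
      have "(\<lambda>n. \<phi> (U x n) (sY c y)) \<longlonglongrightarrow> \<psi> x (sY c y)"
        using y N by (intro lim[OF U] Y.subspace_scale)
      moreover have "(\<lambda>n. \<phi> (U x n) (sY c y)) \<longlonglongrightarrow> sZ c (\<psi> x y)"
        using Z_tendsto[OF lim[OF U y]] in_M[OF U] y by (simp add: scale2)
      ultimately show "\<psi> x (sY c y) = sZ c (\<psi> x y)" by (rule LIMSEQ_unique)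
    qed
  next
    fix x y assume "x \<in> M" "y \<in> N"
    from lim[OF X.projection_seq_const[OF this(1)] this(2)] show "\<psi> x y = \<phi> x y"
      by (simp add: LIMSEQ_const_iff)
  next
    fix x y assume y: "y \<in> N"
    obtain p where p: "U x \<longlonglongrightarrow> p" "norm p \<le> norm x"
      using X.projection_seq_limit[OF U] .
    have "norm (\<psi> x y) \<le> C * norm p * norm y"
    proof (rule LIMSEQ_le)
      show "(\<lambda>n. norm (\<phi> (U x n) y)) \<longlonglongrightarrow> norm (\<psi> x y)" by (intro tendsto_norm lim[OF U y])
      show "(\<lambda>n. C * norm (U x n) * norm y) \<longlonglongrightarrow> C * norm p * norm y" by (intro tendsto_intros p)
    qed (use C(1)[OF in_M[OF U] y] in blast)
    also have "\<dots> \<le> C * norm x * norm y" using p C by (intro mult_mono) auto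
    finally show "norm (\<psi> x y) \<le> C * norm x * norm y" .
  qed
qed

section \<open>Extension in both variables\<close>

lemma bilinear_on_swap:
  "bilinear_on sX sY sZ M N \<phi> \<Longrightarrow> bilinear_on sY sX sZ N M (\<lambda>y x. \<phi> x y)"
  unfolding bilinear_on_def by blast

text \<open>
  The ratios that define the norm omit zero arguments; vanishing there turns their bound into an
  estimate on all of \<open>M \<times> N\<close>.
\<close>

lemma bilinear_on_zero:
  assumes "normed_space_over sX" "normed_space_over sY" "normed_space_over sZ"
    and "bilinear_on sX sY sZ M N \<phi>" "x \<in> M" "y \<in> N" "x = 0 \<or> y = 0"
  shows "\<phi> x y = 0"
proof -
  interpret X: normed_space_over sX by fact
  interpret Y: normed_space_over sY by fact
  interpret Z: normed_space_over sZ by fact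
  have "\<phi> (sX 0 x) y = sZ 0 (\<phi> x y)" "\<phi> x (sY 0 y) = sZ 0 (\<phi> x y)"
    using assms unfolding bilinear_on_def by blast+
  with \<open>x = 0 \<or> y = 0\<close> show ?thesis by auto
qed

theorem corollary5p3:
  fixes sX :: "'f::real_or_complex \<Rightarrow> 'x::banach \<Rightarrow> 'x"
    and sY :: "'f \<Rightarrow> 'y::banach \<Rightarrow> 'y"
    and sZ :: "'f \<Rightarrow> 'z::banach \<Rightarrow> 'z"
    and ipX :: "'x \<Rightarrow> 'x \<Rightarrow> 'f"
    and ipY :: "'y \<Rightarrow> 'y \<Rightarrow> 'f"
    and M :: "'x set" and N :: "'y set"
    and \<phi> :: "'x \<Rightarrow> 'y \<Rightarrow> 'z"
  assumes "hilbert_space_over sX ipX" and "\<exists>x::'x. x \<noteq> 0"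
    and "hilbert_space_over sY ipY" and "\<exists>y::'y. y \<noteq> 0"
    and "normed_space_over sZ"
    and "module.subspace sX M" and "M \<noteq> {0}"
    and "module.subspace sY N" and "N \<noteq> {0}"
    and "bounded_bilinear_on sX sY sZ M N \<phi>"
  shows "\<exists>\<psi>. bounded_bilinear_on sX sY sZ UNIV UNIV \<psi> \<and>
           (\<forall>x\<in>M. \<forall>y\<in>N. \<psi> x y = \<phi> x y) \<and>
           bilinear_norm_on UNIV UNIV \<psi> = bilinear_norm_on M N \<phi>"
proof -
  interpret X: hilbert_space_over sX ipX by fact
  interpret Y: hilbert_space_over sY ipY by fact
  interpret Z: normed_space_over sZ by fact
  note nX = X.normed_space_over_axioms and nY = Y.normed_space_over_axioms
  have \<phi>: "bilinear_on sX sY sZ M N \<phi>" and bdd: "bdd_above (bilinear_ratios M N \<phi>)"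
    using assms(10) unfolding bounded_bilinear_on_def by auto
  define C where "C = bilinear_norm_on M N \<phi>"
  have ratio_le: "r \<le> C" if "r \<in> bilinear_ratios M N \<phi>" for r
    unfolding C_def bilinear_norm_on_def by (rule cSup_upper[OF that bdd])
  obtain x0 y0 where "x0 \<in> M" "x0 \<noteq> 0" "y0 \<in> N" "y0 \<noteq> 0"
    using assms(6-9) X.subspace_0 Y.subspace_0 by blast
  then have r0: "norm (\<phi> x0 y0) / (norm x0 * norm y0) \<in> bilinear_ratios M N \<phi>"
    unfolding bilinear_ratios_def by blast
  have "0 \<le> norm (\<phi> x0 y0) / (norm x0 * norm y0)" by simp
  also have "\<dots> \<le> C" by (rule ratio_le[OF r0])
  finally have C0: "0 \<le> C" .
  have C: "norm (\<phi> x y) \<le> C * norm x * norm y" if xy: "x \<in> M" "y \<in> N" for x y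
  proof (cases "x = 0 \<or> y = 0")
    case True
    then show ?thesis
      using bilinear_on_zero[OF nX nY assms(5) \<phi> xy] by auto
  next
    case False
    then have "norm (\<phi> x y) / (norm x * norm y) \<le> C"
      using xy by (intro ratio_le) (auto simp: bilinear_ratios_def)
    with False show ?thesis by (simp add: field_simps)
  qed
  obtain \<psi>\<^sub>1 where 1: "bilinear_on sX sY sZ UNIV N \<psi>\<^sub>1"
    "\<And>x y. x \<in> M \<Longrightarrow> y \<in> N \<Longrightarrow> \<psi>\<^sub>1 x y = \<phi> x y"
    "\<And>x y. y \<in> N \<Longrightarrow> norm (\<psi>\<^sub>1 x y) \<le> C * norm x * norm y"
    using extend_first_variable[OF assms(1) nY assms(5,6,8) \<phi> C C0] by metis
  have bound1: "norm (\<psi>\<^sub>1 x y) \<le> C * norm y * norm x" if "y \<in> N" for x y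
    using 1(3)[OF that, of x] by (simp add: mult_ac)
  obtain \<psi>\<^sub>2 where 2: "bilinear_on sY sX sZ UNIV UNIV \<psi>\<^sub>2"
    "\<And>x y. y \<in> N \<Longrightarrow> \<psi>\<^sub>2 y x = \<psi>\<^sub>1 x y"
    "\<And>x y. norm (\<psi>\<^sub>2 y x) \<le> C * norm y * norm x"
    using extend_first_variable[OF assms(3) nX assms(5,8) X.subspace_UNIV bilinear_on_swap[OF 1(1)]
        bound1 C0] by (metis UNIV_I)
  define \<psi> where "\<psi> x y = \<psi>\<^sub>2 y x" for x y
  have \<psi>: "bilinear_on sX sY sZ UNIV UNIV \<psi>"
    using bilinear_on_swap[OF 2(1)] by (simp add: \<psi>_def[abs_def])
  have agree: "\<psi> x y = \<phi> x y" if "x \<in> M" "y \<in> N" for x y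
    using that 1(2) 2(2) by (simp add: \<psi>_def)
  have upper: "r \<le> C" if "r \<in> bilinear_ratios UNIV UNIV \<psi>" for r
  proof -
    obtain x y where "r = norm (\<psi> x y) / (norm x * norm y)" "x \<noteq> 0" "y \<noteq> 0"
      using \<open>r \<in> _\<close> unfolding bilinear_ratios_def by blast
    with 2(3)[of y x] show ?thesis by (simp add: \<psi>_def pos_divide_le_eq mult_ac)
  qed
  then have bdd': "bdd_above (bilinear_ratios UNIV UNIV \<psi>)" by (rule bdd_aboveI)
  have sub: "bilinear_ratios M N \<phi> \<subseteq> bilinear_ratios UNIV UNIV \<psi>"
  proof
    fix r assume "r \<in> bilinear_ratios M N \<phi>"
    then obtain x y where "r = norm (\<phi> x y) / (norm x * norm y)" "x \<in> M" "x \<noteq> 0" "y \<in> N" "y \<noteq> 0"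
      unfolding bilinear_ratios_def by blast
    moreover from this have "\<psi> x y = \<phi> x y" by (intro agree)
    ultimately show "r \<in> bilinear_ratios UNIV UNIV \<psi>"
      unfolding bilinear_ratios_def by (metis (mono_tags, lifting) UNIV_I mem_Collect_eq)
  qed
  have "bilinear_norm_on UNIV UNIV \<psi> \<le> C"
    unfolding bilinear_norm_on_def by (rule cSup_least) (use r0 sub upper in blast)+
  moreover have "C \<le> bilinear_norm_on UNIV UNIV \<psi>"
    unfolding C_def bilinear_norm_on_def by (rule cSup_subset_mono) (use r0 sub bdd' in blast)+
  ultimately show ?thesis
    using \<psi> bdd' agree unfolding bounded_bilinear_on_def C_def by (intro exI[of _ \<psi>]) auto
qed

end
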